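(* Let $G$ and $H$ be strong digraphs, each of order at least 2. Then the arc set of $G\boxtimes H$ can be partitioned into two sets $A_1,A_2$ such that both spanning subdigraphs $(V(G\boxtimes H),A_1)$ and $(V(G\boxtimes H),A_2)$ are strong. Moreover, such a partition can be found in polynomial time.
   Context: All digraphs are finite, without loops or parallel arcs. A digraph is strong if for every ordered pair of distinct vertices $x,y$ there is a directed path from $x$ to $y$. The strong product $G\boxtimes H$ has vertex set $V(G)\times V(H)$ and an arc $(x,x')(y,y')$ whenever either $xy\in A(G)$ and $x'=y'$, or $x=y$ and $x'y'\in A(H)$, or $xy\in A(G)$ and $x'y'\in A(H)$. *)

theory Defs
  imports
    "Graph_Theory.Graph_Theory"
    "HOL-Computational_Algebra.Polynomial"
begin

section \<open>Strong products and decompositions of the arc set\<close>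

text \<open>
  Finite digraphs without loops or parallel arcs are those satisfying \<^const>\<open>pair_digraph\<close>.
  For digraphs with a vertex, \<^const>\<open>strongly_connected\<close> is strongness: the reachability
  of a vertex from itself, which it also asks for, always holds.
\<close>

definition strong_product ::
    "'a pair_pre_digraph \<Rightarrow> 'b pair_pre_digraph \<Rightarrow> ('a \<times> 'b) pair_pre_digraph"
    (infixl \<open>\<boxtimes>\<close> 70) where
  "G \<boxtimes> H = \<lparr>
     pverts = pverts G \<times> pverts H,
     parcs = {((x, x'), (y, y')) | x x' y y'.
       x \<in> pverts G \<and> y \<in> pverts G \<and> x' \<in> pverts H \<and> y' \<in> pverts H \<and>
       ((x, y) \<in> parcs G \<and> x' = y' \<or>
        x = y \<and> (x', y') \<in> parcs H \<or>
        (x, y) \<in> parcs G \<and> (x', y') \<in> parcs H)} \<rparr>"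

definition strong_arc_partition :: "'a pair_pre_digraph \<Rightarrow> 'a rel \<Rightarrow> 'a rel \<Rightarrow> bool" where
  "strong_arc_partition D A\<^sub>1 A\<^sub>2 \<longleftrightarrow>
     A\<^sub>1 \<union> A\<^sub>2 = parcs D \<and> A\<^sub>1 \<inter> A\<^sub>2 = {} \<and>
     strongly_connected (with_proj \<lparr> pverts = pverts D, parcs = A\<^sub>1 \<rparr>) \<and>
     strongly_connected (with_proj \<lparr> pverts = pverts D, parcs = A\<^sub>2 \<rparr>)"

section \<open>Model of computation\<close>

text \<open>
  Polynomial time is expressed with the WHILE language of N. D. Jones, \<^emph>\<open>Computability and
  Complexity from a Programming Perspective\<close> (MIT Press, 1997). Data are binary trees over a
  single atom, and every elementary operation takes one unit of time; on trees represented by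
  pointers with sharing, each operation is one pointer operation. Polynomial time in this
  language coincides with polynomial time on Turing machines. (A tree built by sharing may be
  exponentially larger than the time spent on it, but a program whose outputs have polynomial
  size can still be simulated in polynomial time.) The conditional, which
  is definable by loops in Jones's core language, is taken as primitive.
\<close>

datatype tree = Atom | Branch tree tree

fun left :: "tree \<Rightarrow> tree" where
  "left Atom = Atom"
| "left (Branch s t) = s"

fun right :: "tree \<Rightarrow> tree" where
  "right Atom = Atom"
| "right (Branch s t) = t"

datatype expr = Var nat | Quote_Atom | Cons_Expr expr expr | Left expr | Right expr

type_synonym store = "nat \<Rightarrow> tree"

fun expr_val :: "expr \<Rightarrow> store \<Rightarrow> tree" where
  "expr_val (Var i) s = s i"
| "expr_val Quote_Atom s = Atom"
| "expr_val (Cons_Expr e f) s = Branch (expr_val e s) (expr_val f s)"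
| "expr_val (Left e) s = left (expr_val e s)"
| "expr_val (Right e) s = right (expr_val e s)"

fun expr_time :: "expr \<Rightarrow> nat" where
  "expr_time (Var i) = 1"
| "expr_time Quote_Atom = 1"
| "expr_time (Cons_Expr e f) = 1 + expr_time e + expr_time f"
| "expr_time (Left e) = 1 + expr_time e"
| "expr_time (Right e) = 1 + expr_time e"

datatype com =
    Assign nat expr
  | Seq com com
  | Cond expr com com
  | While expr com

text \<open>
  \<open>exec c s t s'\<close>: started in store \<open>s\<close>, command \<open>c\<close> halts in store \<open>s'\<close> after \<open>t\<close> time units.
  The atom represents the truth value false, all other trees represent true.
\<close>

inductive exec :: "com \<Rightarrow> store \<Rightarrow> nat \<Rightarrow> store \<Rightarrow> bool" where
  Assign: "exec (Assign i e) s (1 + expr_time e) (s(i := expr_val e s))"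
| Seq: "exec c s t s' \<Longrightarrow> exec d s' t' s'' \<Longrightarrow> exec (Seq c d) s (1 + t + t') s''"
| CondTrue: "expr_val e s \<noteq> Atom \<Longrightarrow> exec c s t s' \<Longrightarrow>
    exec (Cond e c d) s (1 + expr_time e + t) s'"
| CondFalse: "expr_val e s = Atom \<Longrightarrow> exec d s t s' \<Longrightarrow>
    exec (Cond e c d) s (1 + expr_time e + t) s'"
| WhileFalse: "expr_val e s = Atom \<Longrightarrow> exec (While e c) s (1 + expr_time e) s"
| WhileTrue: "expr_val e s \<noteq> Atom \<Longrightarrow> exec c s t s' \<Longrightarrow> exec (While e c) s' t' s'' \<Longrightarrow>
    exec (While e c) s (1 + expr_time e + t + t') s''"

lemma exec_deterministic:
  assumes "exec c s t s'" and "exec c s u s''"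
  shows "t = u \<and> s' = s''"
  using assms
proof (induction arbitrary: u s'' rule: exec.induct)
  case (Assign i e s)
  then show ?case by (auto elim: exec.cases)
next
  case (Seq c s t s' d t' s'')
  from Seq.prems Seq.IH show ?case by (cases rule: exec.cases) blast+
next
  case (CondTrue e s c t s' d)
  from CondTrue.prems CondTrue.hyps CondTrue.IH show ?case by (cases rule: exec.cases) blast+
next
  case (CondFalse e s d t s' c)
  from CondFalse.prems CondFalse.hyps CondFalse.IH show ?case by (cases rule: exec.cases) blast+
next
  case (WhileFalse e s c)
  from WhileFalse.prems WhileFalse.hyps show ?case by (cases rule: exec.cases) blast+
next
  case (WhileTrue e s c t s' t' s'')
  from WhileTrue.prems WhileTrue.hyps WhileTrue.IH show ?case by (cases rule: exec.cases) blast+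
qed

text \<open>Variable 0 holds both the input and the output; all other variables start as the atom.\<close>

definition computes :: "com \<Rightarrow> tree \<Rightarrow> nat \<Rightarrow> tree \<Rightarrow> bool" where
  "computes c inp t out \<longleftrightarrow> (\<exists>s. exec c ((\<lambda>_. Atom)(0 := inp)) t s \<and> s 0 = out)"

section \<open>Encoding of digraphs and of partitions\<close>

fun list_tree :: "tree list \<Rightarrow> tree" where
  "list_tree [] = Atom"
| "list_tree (t # ts) = Branch t (list_tree ts)"

definition encodes_set :: "('a \<Rightarrow> tree) \<Rightarrow> tree \<Rightarrow> 'a set \<Rightarrow> bool" where
  "encodes_set f t S \<longleftrightarrow> (\<exists>xs. distinct xs \<and> set xs = S \<and> t = list_tree (map f xs))"

fun pair_tree :: "('a \<Rightarrow> tree) \<Rightarrow> ('b \<Rightarrow> tree) \<Rightarrow> 'a \<times> 'b \<Rightarrow> tree" where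
  "pair_tree f g (x, y) = Branch (f x) (g y)"

text \<open>
  In instances of the algorithmic problem, vertices are named by arbitrary trees. A digraph is
  given by a list of its vertices and a list of its arcs, each without repetitions and in any
  order.
\<close>

definition encodes_digraph :: "tree \<Rightarrow> tree pair_pre_digraph \<Rightarrow> bool" where
  "encodes_digraph t G \<longleftrightarrow> (\<exists>v a. t = Branch v a \<and>
     encodes_set id v (pverts G) \<and> encodes_set (pair_tree id id) a (parcs G))"

definition encodes_instance ::
    "tree \<Rightarrow> tree pair_pre_digraph \<Rightarrow> tree pair_pre_digraph \<Rightarrow> bool" where
  "encodes_instance t G H \<longleftrightarrow>
     (\<exists>g h. t = Branch g h \<and> encodes_digraph g G \<and> encodes_digraph h H)"

definition encodes_arc_sets ::
    "tree \<Rightarrow> (tree \<times> tree) rel \<Rightarrow> (tree \<times> tree) rel \<Rightarrow> bool" where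
  "encodes_arc_sets t A\<^sub>1 A\<^sub>2 \<longleftrightarrow> (\<exists>a\<^sub>1 a\<^sub>2. t = Branch a\<^sub>1 a\<^sub>2 \<and>
     encodes_set (pair_tree (pair_tree id id) (pair_tree id id)) a\<^sub>1 A\<^sub>1 \<and>
     encodes_set (pair_tree (pair_tree id id) (pair_tree id id)) a\<^sub>2 A\<^sub>2)"

end

theory Submission
  imports Defs
begin

text \<open>
  Fix a vertex \<open>h\<close> of \<open>H\<close>. The arcs inside the copies of \<open>H\<close>, together with the arcs inside the
  copy of \<open>G\<close> at \<open>h\<close>, are strong: move to height \<open>h\<close>, change the first coordinate there, and move
  away. The remaining arcs are the diagonal ones and those inside the copies of \<open>G\<close> at the other
  heights. Diagonal arcs lift every walk of \<open>H\<close>, without control over the first coordinate; at a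
  height other than \<open>h\<close> that coordinate can be corrected, and a vertex at height \<open>h\<close> is entered
  diagonally from such a height. Taking for \<open>h\<close> the first vertex in the list of vertices of \<open>H\<close>,
  both parts are listed by nested loops that never compare two vertices.
\<close>

section \<open>The partition\<close>

fun fibre_arc :: "'a \<times> ('b \<times> 'b) \<Rightarrow> ('a \<times> 'b) \<times> ('a \<times> 'b)" where
  "fibre_arc (x, (a, b)) = ((x, a), (x, b))"

fun row_arc :: "('a \<times> 'a) \<times> 'b \<Rightarrow> ('a \<times> 'b) \<times> ('a \<times> 'b)" where
  "row_arc ((x, y), a) = ((x, a), (y, a))"

fun diagonal_arc :: "('a \<times> 'a) \<times> ('b \<times> 'b) \<Rightarrow> ('a \<times> 'b) \<times> ('a \<times> 'b)" where
  "diagonal_arc ((x, y), (a, b)) = ((x, a), (y, b))"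

text \<open>Written as images of Cartesian products, so that mapping the arc functions over
  \<open>List.product\<close> enumerates exactly these sets.\<close>

definition fibre_part ::
    "'a pair_pre_digraph \<Rightarrow> 'b pair_pre_digraph \<Rightarrow> 'b \<Rightarrow> ('a \<times> 'b) rel" where
  "fibre_part G H h =
     fibre_arc ` (pverts G \<times> parcs H) \<union> row_arc ` (parcs G \<times> {h})"

definition diagonal_part ::
    "'a pair_pre_digraph \<Rightarrow> 'b pair_pre_digraph \<Rightarrow> 'b \<Rightarrow> ('a \<times> 'b) rel" where
  "diagonal_part G H h =
     diagonal_arc ` (parcs G \<times> parcs H) \<union> row_arc ` (parcs G \<times> (pverts H - {h}))"

section \<open>Walks in strong digraphs\<close>

text \<open>Carries a walk of one factor into a copy of that factor inside the product, with
  \<open>f\<close> the embedding of the copy.\<close>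

lemma rtrancl_map:
  assumes "\<And>x y. (x, y) \<in> r \<Longrightarrow> (f x, f y) \<in> s" and "(x, y) \<in> r\<^sup>*"
  shows "(f x, f y) \<in> s\<^sup>*"
  using assms(2) by induction (auto intro: assms(1) rtrancl_into_rtrancl)

lemma mem_fibre_part:
  "((x, a), (y, b)) \<in> fibre_part G H h \<longleftrightarrow>
    x = y \<and> x \<in> pverts G \<and> (a, b) \<in> parcs H \<or> (x, y) \<in> parcs G \<and> a = b \<and> a = h"
  by (force simp: fibre_part_def)

lemma mem_diagonal_part:
  "((x, a), (y, b)) \<in> diagonal_part G H h \<longleftrightarrow>
    (x, y) \<in> parcs G \<and> (a, b) \<in> parcs H \<or>
    (x, y) \<in> parcs G \<and> a = b \<and> a \<in> pverts H \<and> a \<noteq> h"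
  by (force simp: diagonal_part_def)

text \<open>Replaces reachability confined to the vertex set by plain \<open>rtrancl\<close>, so
  that walks can be composed and mapped as relations.\<close>

lemma strongly_connected_iff_rtrancl:
  assumes "parcs G \<subseteq> pverts G \<times> pverts G"
  shows "strongly_connected (with_proj G) \<longleftrightarrow>
    pverts G \<noteq> {} \<and> (\<forall>u \<in> pverts G. \<forall>v \<in> pverts G. (u, v) \<in> (parcs G)\<^sup>*)"
proof -
  interpret pair_wf_digraph G
    using assms by unfold_locales auto
  show ?thesis
    by (auto simp: strongly_connected_def reachable_conv)
qed

lemma pair_digraph_parcs:
  assumes "pair_digraph G"
  shows "parcs G \<subseteq> pverts G \<times> pverts G" and "(u, u) \<notin> parcs G"
proof -
  interpret pair_digraph G by fact
  show "parcs G \<subseteq> pverts G \<times> pverts G"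
    by (auto dest: in_arcsD1 in_arcsD2)
  show "(u, u) \<notin> parcs G"
    using pair_no_loops[of "(u, u)"] by auto
qed

lemma strong_digraph_rtrancl:
  assumes "pair_digraph G" "strongly_connected (with_proj G)" "u \<in> pverts G" "v \<in> pverts G"
  shows "(u, v) \<in> (parcs G)\<^sup>*"
  using assms strongly_connected_iff_rtrancl[OF pair_digraph_parcs(1)] by blast

text \<open>A second vertex \<open>z\<close> exists because the order is at least 2. The walks
  between \<open>u\<close> and \<open>z\<close> are then nonempty, so one ends with an arc into
  \<open>u\<close> and the other starts with an arc out of \<open>u\<close>.\<close>

lemma strong_digraph_neighbours:
  assumes "pair_digraph G" "strongly_connected (with_proj G)" "card (pverts G) \<ge> 2"
    and u: "u \<in> pverts G"
  obtains v w where "v \<in> pverts G" "(v, u) \<in> parcs G" "w \<in> pverts G" "(u, w) \<in> parcs G"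
proof -
  have "pverts G \<noteq> {u}"
    using assms(3) by auto
  then obtain z where z: "z \<in> pverts G" "z \<noteq> u"
    using u by blast
  have zu: "(z, u) \<in> (parcs G)\<^sup>*" and uz: "(u, z) \<in> (parcs G)\<^sup>*"
    using strong_digraph_rtrancl[OF assms(1,2)] u z by blast+
  from zu obtain v where "(v, u) \<in> parcs G"
    using z by (metis rtranclE)
  moreover from uz obtain w where "(u, w) \<in> parcs G"
    using z by (metis converse_rtranclE)
  ultimately show thesis
    using that pair_digraph_parcs(1)[OF assms(1)] by blast
qed

section \<open>Strongness of the two arc sets\<close>

lemma strongly_connected_fibre_part:
  assumes G: "pair_digraph G" "strongly_connected (with_proj G)"
    and H: "pair_digraph H" "strongly_connected (with_proj H)" and h: "h \<in> pverts H"
  shows "strongly_connected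
    (with_proj \<lparr> pverts = pverts G \<times> pverts H, parcs = fibre_part G H h \<rparr>)"
proof -
  let ?R = "fibre_part G H h"
  have fibre: "((x, a), (x, b)) \<in> ?R\<^sup>*"
    if "x \<in> pverts G" "a \<in> pverts H" "b \<in> pverts H" for x a b
  proof (rule rtrancl_map[where f = "Pair x"])
    show "(Pair x a, Pair x b) \<in> ?R" if "(a, b) \<in> parcs H" for a b
      using \<open>x \<in> pverts G\<close> that by (simp add: mem_fibre_part)
    show "(a, b) \<in> (parcs H)\<^sup>*"
      using strong_digraph_rtrancl[OF H] that by blast
  qed
  have row: "((x, h), (y, h)) \<in> ?R\<^sup>*" if "x \<in> pverts G" "y \<in> pverts G" for x y
  proof (rule rtrancl_map[where f = "\<lambda>x. (x, h)"])
    show "((x, h), (y, h)) \<in> ?R" if "(x, y) \<in> parcs G" for x y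
      using that by (simp add: mem_fibre_part)
    show "(x, y) \<in> (parcs G)\<^sup>*"
      using strong_digraph_rtrancl[OF G] that by blast
  qed
  \<comment> \<open>The walk passes through \<open>(x, h)\<close> and \<open>(y, h)\<close>.\<close>
  have "((x, a), (y, b)) \<in> ?R\<^sup>*"
    if "x \<in> pverts G" "y \<in> pverts G" "a \<in> pverts H" "b \<in> pverts H" for x y a b
    using fibre[of x a h] row[of x y] fibre[of y h b] that h by (meson rtrancl_trans)
  moreover have "?R \<subseteq> (pverts G \<times> pverts H) \<times> (pverts G \<times> pverts H)"
    using pair_digraph_parcs(1)[OF G(1)] pair_digraph_parcs(1)[OF H(1)] h
    by (auto simp: fibre_part_def)
  moreover have "pverts G \<noteq> {}"
    using G(2) by (auto simp: strongly_connected_def)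
  ultimately show ?thesis
    using h by (subst strongly_connected_iff_rtrancl) auto
qed

lemma strongly_connected_diagonal_part:
  assumes G: "pair_digraph G" "strongly_connected (with_proj G)" "card (pverts G) \<ge> 2"
    and H: "pair_digraph H" "strongly_connected (with_proj H)" "card (pverts H) \<ge> 2"
    and h: "h \<in> pverts H"
  shows "strongly_connected
    (with_proj \<lparr> pverts = pverts G \<times> pverts H, parcs = diagonal_part G H h \<rparr>)"
proof -
  let ?R = "diagonal_part G H h"
  have diagonal: "((x, a), (y, b)) \<in> ?R" if "(x, y) \<in> parcs G" "(a, b) \<in> parcs H" for x y a b
    using that by (simp add: mem_diagonal_part)
  have row: "((x, a), (y, a)) \<in> ?R\<^sup>*"
    if "x \<in> pverts G" "y \<in> pverts G" "a \<in> pverts H" "a \<noteq> h" for x y a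
  proof (rule rtrancl_map[where f = "\<lambda>x. (x, a)"])
    show "((x, a), (y, a)) \<in> ?R" if "(x, y) \<in> parcs G" for x y
      using that \<open>a \<in> pverts H\<close> \<open>a \<noteq> h\<close> by (simp add: mem_diagonal_part)
    show "(x, y) \<in> (parcs G)\<^sup>*"
      using strong_digraph_rtrancl[OF G(1,2)] that by blast
  qed
  \<comment> \<open>Each arc of the walk in \<open>H\<close> is paired with some arc of
    \<open>G\<close> leaving the current first coordinate. Such an arc always exists, but its head
    is not chosen, hence the existential quantifier.\<close>
  have lift: "\<exists>y \<in> pverts G. ((x, a), (y, b)) \<in> ?R\<^sup>*"
    if "(a, b) \<in> (parcs H)\<^sup>*" "x \<in> pverts G" for x a b
    using that(1)
  proof (induction rule: rtrancl_induct)
    case base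
    then show ?case using that(2) by blast
  next
    case (step b c)
    then obtain y where y: "y \<in> pverts G" "((x, a), (y, b)) \<in> ?R\<^sup>*"
      by blast
    obtain z where "z \<in> pverts G" "(y, z) \<in> parcs G"
      using strong_digraph_neighbours[OF G y(1)] by metis
    then show ?case
      using y(2) diagonal step.hyps(2) by (meson rtrancl.rtrancl_into_rtrancl)
  qed
  \<comment> \<open>Away from height \<open>h\<close> the row of the target is available and
    corrects the uncontrolled first coordinate.\<close>
  have off_row: "((x, a), (y, b)) \<in> ?R\<^sup>*"
    if asm: "x \<in> pverts G" "y \<in> pverts G" "a \<in> pverts H" "b \<in> pverts H" "b \<noteq> h" for x y a b
  proof -
    obtain z where "z \<in> pverts G" "((x, a), (z, b)) \<in> ?R\<^sup>*"
      using lift[OF strong_digraph_rtrancl[OF H(1,2) asm(3,4)] asm(1)] by blast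
    then show ?thesis
      using row[of z y b] asm by (meson rtrancl_trans)
  qed
  have on_row: "((x, a), (y, h)) \<in> ?R\<^sup>*"
    if "x \<in> pverts G" "y \<in> pverts G" "a \<in> pverts H" for x y a
  proof -
    obtain b where b: "b \<in> pverts H" "(b, h) \<in> parcs H"
      using strong_digraph_neighbours[OF H h] by metis
    obtain z where z: "z \<in> pverts G" "(z, y) \<in> parcs G"
      using strong_digraph_neighbours[OF G \<open>y \<in> pverts G\<close>] by metis
    \<comment> \<open>Since \<open>H\<close> has no loop at \<open>h\<close>, the in-neighbour
      \<open>b\<close> is a height to which \<open>off_row\<close> applies. It reaches
      \<open>(z, b)\<close>, from which one diagonal arc leads to \<open>(y, h)\<close>.\<close>
    have "b \<noteq> h"
      using b pair_digraph_parcs(2)[OF H(1)] by blast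
    then show ?thesis
      using off_row[of x z a b] diagonal[OF z(2) b(2)] b z that
      by (meson rtrancl.rtrancl_into_rtrancl)
  qed
  have "((x, a), (y, b)) \<in> ?R\<^sup>*"
    if "x \<in> pverts G" "y \<in> pverts G" "a \<in> pverts H" "b \<in> pverts H" for x y a b
    using off_row on_row that by (cases "b = h") auto
  moreover have "?R \<subseteq> (pverts G \<times> pverts H) \<times> (pverts G \<times> pverts H)"
    using pair_digraph_parcs(1)[OF G(1)] pair_digraph_parcs(1)[OF H(1)]
    by (auto simp: diagonal_part_def)
  moreover have "pverts G \<noteq> {}"
    using G(2) by (auto simp: strongly_connected_def)
  ultimately show ?thesis
    using h by (subst strongly_connected_iff_rtrancl) auto
qed

section \<open>Partition of the arcs of the strong product\<close>

text \<open>Of the three kinds of product arcs, fibre arcs and diagonal arcs each lie in one part.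
  Row arcs are divided according to whether their height is \<open>h\<close>.\<close>

lemma strong_product_parcs:
  assumes "pair_digraph G" "pair_digraph H" "h \<in> pverts H"
  shows "parcs (G \<boxtimes> H) = fibre_part G H h \<union> diagonal_part G H h"
  using pair_digraph_parcs(1)[OF assms(1)] pair_digraph_parcs(1)[OF assms(2)] assms(3)
  by (auto simp: set_eq_iff strong_product_def mem_fibre_part mem_diagonal_part)

text \<open>Without loops, the kind of an arc is determined by which coordinates change. Two row
  arcs from different parts have different heights.\<close>

lemma fibre_part_diagonal_part_disjoint:
  assumes "pair_digraph G" "pair_digraph H"
  shows "fibre_part G H h \<inter> diagonal_part G H h = {}"
  using pair_digraph_parcs(2)[OF assms(1)] pair_digraph_parcs(2)[OF assms(2)]
  by (auto simp: fibre_part_def diagonal_part_def)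

lemma strong_arc_partition_strong_product:
  assumes G: "pair_digraph G" "strongly_connected (with_proj G)" "card (pverts G) \<ge> 2"
    and H: "pair_digraph H" "strongly_connected (with_proj H)" "card (pverts H) \<ge> 2"
    and h: "h \<in> pverts H"
  shows "strong_arc_partition (G \<boxtimes> H) (fibre_part G H h) (diagonal_part G H h)"
proof -
  have "pverts (G \<boxtimes> H) = pverts G \<times> pverts H"
    by (simp add: strong_product_def)
  then show ?thesis
    unfolding strong_arc_partition_def
    using strong_product_parcs[OF G(1) H(1) h] fibre_part_diagonal_part_disjoint[OF G(1) H(1)]
      strongly_connected_fibre_part[OF G(1,2) H(1,2) h]
      strongly_connected_diagonal_part[OF G H h]
    by simp
qed

section \<open>The program\<close>

text \<open>Variables 2 and 3 hold the unread suffixes of the outer and the inner list, so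
  \<open>f\<close> finds the current items at their heads. Results are pushed onto variable
  \<open>k\<close> and therefore appear in reverse order.\<close>

definition collect_row :: "expr \<Rightarrow> nat \<Rightarrow> com" where
  "collect_row f k = While (Var 3)
     (Seq (Assign k (Cons_Expr f (Var k))) (Assign 3 (Right (Var 3))))"

text \<open>The inner loop consumes variable 3, so \<open>e\<close> is evaluated afresh for every
  item of the outer list.\<close>

definition collect_rows :: "expr \<Rightarrow> expr \<Rightarrow> nat \<Rightarrow> com" where
  "collect_rows e f k = While (Var 2)
     (Seq (Assign 3 e) (Seq (collect_row f k) (Assign 2 (Right (Var 2)))))"

definition collect :: "expr \<Rightarrow> expr \<Rightarrow> expr \<Rightarrow> nat \<Rightarrow> com" where
  "collect d e f k = Seq (Assign 2 d) (collect_rows e f k)"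

lemma exec_AssignI:
  "t = 1 + expr_time e \<Longrightarrow> s' = s(i := expr_val e s) \<Longrightarrow> exec (Assign i e) s t s'"
  using exec.Assign by simp

text \<open>A pass costs 2 for the test, \<open>expr_time f + 3\<close> and 3 for the assignments
  and 1 for their sequencing. The final failing test costs 2. The accumulator is arbitrary to make
  the induction work.\<close>

lemma exec_collect_row:
  assumes f: "\<And>s. expr_val f s = \<theta> (left (s 2)) (left (s 3))" and k: "k \<noteq> 2" "k \<noteq> 3"
  shows "s 3 = list_tree qs \<Longrightarrow> s k = list_tree acc \<Longrightarrow>
    exec (collect_row f k) s ((expr_time f + 9) * length qs + 2)
      (s(3 := Atom, k := list_tree (rev (map (\<theta> (left (s 2))) qs) @ acc)))"
proof (induction qs arbitrary: s acc)
  case Nil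
  then have same: "s(3 := Atom, k := list_tree (rev (map (\<theta> (left (s 2))) []) @ acc)) = s"
    by auto
  show ?case
    unfolding same using Nil exec.WhileFalse[of "Var 3" s] by (simp add: collect_row_def)
next
  case (Cons q qs)
  let ?body = "Seq (Assign k (Cons_Expr f (Var k))) (Assign 3 (Right (Var 3)))"
  let ?u = "s(k := list_tree (\<theta> (left (s 2)) q # acc))"
  let ?v = "?u(3 := list_tree qs)"
  have "exec (Assign k (Cons_Expr f (Var k))) s (expr_time f + 3) ?u"
    using f[of s] Cons.prems by (intro exec_AssignI) auto
  moreover have "exec (Assign 3 (Right (Var 3))) ?u 3 ?v"
    using Cons.prems k by (intro exec_AssignI) auto
  ultimately have "exec ?body s (1 + (expr_time f + 3) + 3) ?v"
    by (rule exec.Seq)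
  then have body: "exec ?body s (expr_time f + 7) ?v"
    by (simp add: add.commute)
  have "exec (collect_row f k) ?v ((expr_time f + 9) * length qs + 2)
      (?v(3 := Atom, k := list_tree (rev (map (\<theta> (left (?v 2))) qs) @ (\<theta> (left (s 2)) q # acc))))"
    using k by (intro Cons.IH) auto
  moreover have "?v(3 := Atom,
        k := list_tree (rev (map (\<theta> (left (?v 2))) qs) @ (\<theta> (left (s 2)) q # acc))) =
      s(3 := Atom, k := list_tree (rev (map (\<theta> (left (s 2))) (q # qs)) @ acc))"
    using k by auto
  ultimately have rest: "exec (While (Var 3) ?body) ?v ((expr_time f + 9) * length qs + 2)
      (s(3 := Atom, k := list_tree (rev (map (\<theta> (left (s 2))) (q # qs)) @ acc)))"
    by (simp only: collect_row_def)
  have "expr_val (Var 3) s \<noteq> Atom"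
    using Cons.prems by simp
  from exec.WhileTrue[OF this body rest] show ?case
    unfolding collect_row_def by (rule back_subst[where P = "\<lambda>t. exec _ _ t _"]) simp
qed

text \<open>Besides \<open>e\<close> and the inner passes, an outer pass costs 10: the test 2,
  sequencing 2, the assignments 1 and 3, the last inner test 2. Variable 0 is never written, so
  \<open>e\<close> yields the same list each time. Variables 2 and 3 are scratch space whose final
  contents are left open.\<close>

lemma exec_collect_rows:
  assumes f: "\<And>s. expr_val f s = \<theta> (left (s 2)) (left (s 3))" and k: "k \<noteq> 2" "k \<noteq> 3" "k \<noteq> 0"
    and e: "\<And>s. s 0 = inp \<Longrightarrow> expr_val e s = list_tree qs"
  shows "s 0 = inp \<Longrightarrow> s 2 = list_tree ps \<Longrightarrow> s k = list_tree acc \<Longrightarrow>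
    \<exists>s'. exec (collect_rows e f k) s
        (length ps * ((expr_time f + 9) * length qs + expr_time e + 10) + 2) s' \<and>
      s' k = list_tree (rev (map (case_prod \<theta>) (List.product ps qs)) @ acc) \<and>
      (\<forall>i. i \<notin> {2, 3, k} \<longrightarrow> s' i = s i)"
proof (induction ps arbitrary: s acc)
  case Nil
  then show ?case
    using exec.WhileFalse[of "Var 2" s] by (auto simp: collect_rows_def)
next
  case (Cons p ps)
  let ?body = "Seq (Assign 3 e) (Seq (collect_row f k) (Assign 2 (Right (Var 2))))"
  let ?acc = "rev (map (\<theta> p) qs) @ acc"
  let ?u = "s(3 := list_tree qs)"
  let ?v = "?u(3 := Atom, k := list_tree ?acc)"
  let ?w = "?v(2 := list_tree ps)"
  have "exec (Assign 3 e) s (1 + expr_time e) ?u"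
    using e[of s] Cons.prems by (intro exec_AssignI) auto
  moreover have "exec (collect_row f k) ?u ((expr_time f + 9) * length qs + 2) ?v"
    using exec_collect_row[OF f k(1,2), of ?u qs acc] Cons.prems k by simp
  moreover have "exec (Assign 2 (Right (Var 2))) ?v 3 ?w"
    using Cons.prems k by (intro exec_AssignI) auto
  ultimately have body: "exec ?body s
      (1 + (1 + expr_time e) + (1 + ((expr_time f + 9) * length qs + 2) + 3)) ?w"
    by (intro exec.Seq)
  have "?w 0 = inp" "?w 2 = list_tree ps" "?w k = list_tree ?acc"
    using Cons.prems k by auto
  from Cons.IH[OF this] obtain s' where
    rest: "exec (While (Var 2) ?body) ?w
      (length ps * ((expr_time f + 9) * length qs + expr_time e + 10) + 2) s'"
    and s': "s' k = list_tree (rev (map (case_prod \<theta>) (List.product ps qs)) @ ?acc)"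
      "\<forall>i. i \<notin> {2, 3, k} \<longrightarrow> s' i = ?w i"
    unfolding collect_rows_def by blast
  have "expr_val (Var 2) s \<noteq> Atom"
    using Cons.prems by simp
  from exec.WhileTrue[OF this body rest]
  have "exec (collect_rows e f k) s
      (length (p # ps) * ((expr_time f + 9) * length qs + expr_time e + 10) + 2) s'"
    by (simp add: collect_rows_def algebra_simps)
  moreover have "s' k = list_tree (rev (map (case_prod \<theta>) (List.product (p # ps) qs)) @ acc)"
    using s'(1) by (simp add: comp_def)
  ultimately show ?case
    using s'(2) by (intro exI[of _ s']) auto
qed

text \<open>The bounds fit all four uses: 15 is the time of \<open>diagonal_expr\<close>, the
  slowest arc expression, and 6 that of the expression for the one-element list of \<open>h\<close>.
  The factor 24 is 15 + 9.\<close>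

lemma exec_collect:
  assumes f: "\<And>s. expr_val f s = \<theta> (left (s 2)) (left (s 3))" and k: "k \<noteq> 2" "k \<noteq> 3" "k \<noteq> 0"
    and e: "\<And>s. s 0 = inp \<Longrightarrow> expr_val e s = list_tree qs"
    and d: "\<And>s. s 0 = inp \<Longrightarrow> expr_val d s = list_tree ps"
    and s: "s 0 = inp" "s k = list_tree acc"
    and small: "expr_time f \<le> 15" "expr_time e \<le> 6" "expr_time d \<le> 6"
      "length ps \<le> n" "length qs \<le> n"
  shows "\<exists>t s'. exec (collect d e f k) s t s' \<and> t \<le> 24 * (n + 1)\<^sup>2 \<and>
      s' k = list_tree (rev (map (case_prod \<theta>) (List.product ps qs)) @ acc) \<and>
      (\<forall>i. i \<notin> {2, 3, k} \<longrightarrow> s' i = s i)"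
proof -
  let ?u = "s(2 := list_tree ps)"
  let ?t = "length ps * ((expr_time f + 9) * length qs + expr_time e + 10) + 2"
  have "?u 0 = inp" "?u 2 = list_tree ps" "?u k = list_tree acc"
    using s k by auto
  from exec_collect_rows[OF f k e this] obtain s' where
    s': "exec (collect_rows e f k) ?u ?t s'"
      "s' k = list_tree (rev (map (case_prod \<theta>) (List.product ps qs)) @ acc)"
      "\<forall>i. i \<notin> {2, 3, k} \<longrightarrow> s' i = ?u i"
    by blast
  have "exec (Assign 2 d) s (1 + expr_time d) ?u"
    using d[of s] s(1) by (intro exec_AssignI) auto
  from exec.Seq[OF this s'(1)] have "exec (collect d e f k) s (1 + (1 + expr_time d) + ?t) s'"
    by (simp add: collect_def)
  moreover have "?t \<le> n * (24 * n + 6 + 10) + 2"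
    using small by (intro add_mono mult_mono order_refl) auto
  then have "1 + (1 + expr_time d) + ?t \<le> 24 * (n + 1)\<^sup>2"
    using small(3) by (simp add: power2_eq_square algebra_simps)
  moreover have "\<forall>i. i \<notin> {2, 3, k} \<longrightarrow> s' i = s i"
    using s'(3) by simp
  ultimately show ?thesis
    using s'(2) by blast
qed

section \<open>The concrete program, its output and its running time\<close>

definition G_verts_expr :: expr where "G_verts_expr = Left (Left (Var 0))"
definition G_arcs_expr :: expr where "G_arcs_expr = Right (Left (Var 0))"
definition H_verts_expr :: expr where "H_verts_expr = Left (Right (Var 0))"
definition H_arcs_expr :: expr where "H_arcs_expr = Right (Right (Var 0))"

definition fibre_expr :: expr where
  "fibre_expr = Cons_Expr
     (Cons_Expr (Left (Var 2)) (Left (Left (Var 3))))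
     (Cons_Expr (Left (Var 2)) (Right (Left (Var 3))))"

definition row_expr :: expr where
  "row_expr = Cons_Expr
     (Cons_Expr (Left (Left (Var 2))) (Left (Var 3)))
     (Cons_Expr (Right (Left (Var 2))) (Left (Var 3)))"

definition diagonal_expr :: expr where
  "diagonal_expr = Cons_Expr
     (Cons_Expr (Left (Left (Var 2))) (Left (Left (Var 3))))
     (Cons_Expr (Right (Left (Var 2))) (Right (Left (Var 3))))"

text \<open>Variable 4 accumulates the fibre part and variable 5 the diagonal part, in two passes
  each. The head of the vertex list of \<open>H\<close> acts as \<open>h\<close>: pairing it with
  the atom gives a one-element list for the rows at \<open>h\<close>, and the tail lists the other
  heights.\<close>

definition partition_program :: com where
  "partition_program =
     Seq (collect G_verts_expr H_arcs_expr fibre_expr 4)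
    (Seq (collect G_arcs_expr (Cons_Expr (Left H_verts_expr) Quote_Atom) row_expr 4)
    (Seq (collect G_arcs_expr H_arcs_expr diagonal_expr 5)
    (Seq (collect G_arcs_expr (Right H_verts_expr) row_expr 5)
         (Assign 0 (Cons_Expr (Var 4) (Var 5))))))"

lemmas partition_expr_defs =
  G_verts_expr_def G_arcs_expr_def H_verts_expr_def H_arcs_expr_def
  fibre_expr_def row_expr_def diagonal_expr_def

lemma length_le_size_list_tree: "length ts \<le> size (list_tree ts)"
  by (induction ts) auto

text \<open>The loops run over lists of encoded items; this moves the encoding outside the
  product.\<close>

lemma map_product: "List.product (map f xs) (map g ys) = map (map_prod f g) (List.product xs ys)"
  by (induction xs) auto

abbreviation (input) arc_tree :: "tree \<times> tree \<Rightarrow> tree" where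
  "arc_tree \<equiv> pair_tree id id"

abbreviation (input) product_arc_tree :: "(tree \<times> tree) \<times> (tree \<times> tree) \<Rightarrow> tree" where
  "product_arc_tree \<equiv> pair_tree arc_tree arc_tree"

lemma partition_program_computes:
  fixes vG vH :: "tree list" and aG aH :: "(tree \<times> tree) list" and h :: tree
  defines "inp \<equiv> Branch
      (Branch (list_tree (map id vG)) (list_tree (map arc_tree aG)))
      (Branch (list_tree (map id (h # vH))) (list_tree (map arc_tree aH)))"
  shows "\<exists>t. computes partition_program inp t (Branch
      (list_tree (map product_arc_tree
        (rev (map row_arc (List.product aG [h])) @ rev (map fibre_arc (List.product vG aH)))))
      (list_tree (map product_arc_tree
        (rev (map row_arc (List.product aG vH)) @ rev (map diagonal_arc (List.product aG aH)))))) \<and>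
    t \<le> 104 * (size inp + 1)\<^sup>2"
proof -
  define n where "n = size inp"
  \<comment> \<open>These three functions are the values of the arc expressions on the current
    items; \<open>left\<close> and \<open>right\<close> recover the ends of an encoded arc.\<close>
  define fibre where
    "fibre p q = Branch (Branch p (left q)) (Branch p (right q))" for p q
  define row where
    "row p q = Branch (Branch (left p) q) (Branch (right p) q)" for p q
  define diagonal where
    "diagonal p q = Branch (Branch (left p) (left q)) (Branch (right p) (right q))" for p q
  \<comment> \<open>The bound for the one-element list holds because \<open>inp\<close> is a branch
    and so has positive size.\<close>
  have lengths: "length (map id vG) \<le> n" "length (map arc_tree aG) \<le> n"
    "length (map id vH) \<le> n" "length (map arc_tree aH) \<le> n" "length (map id [h]) \<le> n"
    using length_le_size_list_tree[of "map id vG"] length_le_size_list_tree[of "map arc_tree aG"]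
      length_le_size_list_tree[of "map id vH"] length_le_size_list_tree[of "map arc_tree aH"]
    by (simp_all add: n_def inp_def)

  have fibre_map: "map (case_prod fibre) (List.product (map id vG) (map arc_tree aH)) =
      map product_arc_tree (map fibre_arc (List.product vG aH))"
    unfolding map_product map_map by (rule map_cong) (auto simp: fibre_def)
  have row_map: "map (case_prod row) (List.product (map arc_tree aG) (map id ys)) =
      map product_arc_tree (map row_arc (List.product aG ys))" for ys
    unfolding map_product map_map by (rule map_cong) (auto simp: row_def)
  have diagonal_map: "map (case_prod diagonal) (List.product (map arc_tree aG) (map arc_tree aH)) =
      map product_arc_tree (map diagonal_arc (List.product aG aH))"
    unfolding map_product map_map by (rule map_cong) (auto simp: diagonal_def)

  \<comment> \<open>The initial atom in variables 4 and 5 is already the empty list, so the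
    accumulators need no initialisation.\<close>
  define s0 where "s0 = ((\<lambda>_. Atom)(0 := inp) :: store)"
  have "\<exists>t s'. exec (collect G_verts_expr H_arcs_expr fibre_expr 4) s0 t s' \<and>
      t \<le> 24 * (n + 1)\<^sup>2 \<and>
      s' 4 = list_tree (rev (map (case_prod fibre)
        (List.product (map id vG) (map arc_tree aH))) @ []) \<and>
      (\<forall>i. i \<notin> {2, 3, 4} \<longrightarrow> s' i = s0 i)"
    by (rule exec_collect[where inp = inp])
      (use lengths in \<open>auto simp: partition_expr_defs fibre_def inp_def s0_def\<close>)
  then obtain t1 s1 where
    1: "exec (collect G_verts_expr H_arcs_expr fibre_expr 4) s0 t1 s1" "t1 \<le> 24 * (n + 1)\<^sup>2"
      "s1 4 = list_tree (rev (map product_arc_tree (map fibre_arc (List.product vG aH))))"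
      "\<And>i. i \<notin> {2, 3, 4} \<Longrightarrow> s1 i = s0 i"
    unfolding fibre_map by auto
  have "\<exists>t s'. exec (collect G_arcs_expr (Cons_Expr (Left H_verts_expr) Quote_Atom) row_expr 4)
        s1 t s' \<and>
      t \<le> 24 * (n + 1)\<^sup>2 \<and>
      s' 4 = list_tree (rev (map (case_prod row)
        (List.product (map arc_tree aG) (map id [h]))) @
        rev (map product_arc_tree (map fibre_arc (List.product vG aH)))) \<and>
      (\<forall>i. i \<notin> {2, 3, 4} \<longrightarrow> s' i = s1 i)"
    by (rule exec_collect[where inp = inp])
      (use lengths 1(3) 1(4)[of 0] in \<open>auto simp: partition_expr_defs row_def inp_def s0_def\<close>)
  then obtain t2 s2 where
    2: "exec (collect G_arcs_expr (Cons_Expr (Left H_verts_expr) Quote_Atom) row_expr 4) s1 t2 s2"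
      "t2 \<le> 24 * (n + 1)\<^sup>2"
      "s2 4 = list_tree (rev (map product_arc_tree (map row_arc (List.product aG [h]))) @
        rev (map product_arc_tree (map fibre_arc (List.product vG aH))))"
      "\<And>i. i \<notin> {2, 3, 4} \<Longrightarrow> s2 i = s1 i"
    unfolding row_map by auto
  have "\<exists>t s'. exec (collect G_arcs_expr H_arcs_expr diagonal_expr 5) s2 t s' \<and>
      t \<le> 24 * (n + 1)\<^sup>2 \<and>
      s' 5 = list_tree (rev (map (case_prod diagonal)
        (List.product (map arc_tree aG) (map arc_tree aH))) @ []) \<and>
      (\<forall>i. i \<notin> {2, 3, 5} \<longrightarrow> s' i = s2 i)"
    by (rule exec_collect[where inp = inp])
      (use lengths 1(4)[of 0] 2(4)[of 0] 1(4)[of 5] 2(4)[of 5] in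
        \<open>auto simp: partition_expr_defs diagonal_def inp_def s0_def\<close>)
  then obtain t3 s3 where
    3: "exec (collect G_arcs_expr H_arcs_expr diagonal_expr 5) s2 t3 s3" "t3 \<le> 24 * (n + 1)\<^sup>2"
      "s3 5 = list_tree (rev (map product_arc_tree (map diagonal_arc (List.product aG aH))))"
      "\<And>i. i \<notin> {2, 3, 5} \<Longrightarrow> s3 i = s2 i"
    unfolding diagonal_map by auto
  have "\<exists>t s'. exec (collect G_arcs_expr (Right H_verts_expr) row_expr 5) s3 t s' \<and>
      t \<le> 24 * (n + 1)\<^sup>2 \<and>
      s' 5 = list_tree (rev (map (case_prod row)
        (List.product (map arc_tree aG) (map id vH))) @
        rev (map product_arc_tree (map diagonal_arc (List.product aG aH)))) \<and>
      (\<forall>i. i \<notin> {2, 3, 5} \<longrightarrow> s' i = s3 i)"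
    by (rule exec_collect[where inp = inp])
      (use lengths 1(4)[of 0] 2(4)[of 0] 3(4)[of 0] 3(3) in
        \<open>auto simp: partition_expr_defs row_def inp_def s0_def\<close>)
  then obtain t4 s4 where
    4: "exec (collect G_arcs_expr (Right H_verts_expr) row_expr 5) s3 t4 s4"
      "t4 \<le> 24 * (n + 1)\<^sup>2"
      "s4 5 = list_tree (rev (map product_arc_tree (map row_arc (List.product aG vH))) @
        rev (map product_arc_tree (map diagonal_arc (List.product aG aH))))"
      "\<And>i. i \<notin> {2, 3, 5} \<Longrightarrow> s4 i = s3 i"
    unfolding row_map by auto
  \<comment> \<open>The last two passes leave variable 4 unchanged.\<close>
  have "s4 4 = s2 4"
    using 3(4)[of 4] 4(4)[of 4] by simp
  then have out: "Branch (s4 4) (s4 5) = Branch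
      (list_tree (map product_arc_tree
        (rev (map row_arc (List.product aG [h])) @ rev (map fibre_arc (List.product vG aH)))))
      (list_tree (map product_arc_tree
        (rev (map row_arc (List.product aG vH)) @ rev (map diagonal_arc (List.product aG aH)))))"
    by (simp only: 2(3) 4(3) rev_map map_append)
  have "exec (Assign 0 (Cons_Expr (Var 4) (Var 5))) s4 4 (s4(0 := Branch (s4 4) (s4 5)))"
    by (intro exec_AssignI) auto
  with 1(1) 2(1) 3(1) 4(1) have "exec partition_program s0
      (1 + t1 + (1 + t2 + (1 + t3 + (1 + t4 + 4)))) (s4(0 := Branch (s4 4) (s4 5)))"
    unfolding partition_program_def by (intro exec.Seq)
  then have "computes partition_program inp (1 + t1 + (1 + t2 + (1 + t3 + (1 + t4 + 4))))
      (Branch (s4 4) (s4 5))"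
    unfolding computes_def s0_def by fastforce
  \<comment> \<open>The four passes account for 96 in the constant 104. The remaining 8 covers four
    sequencing steps and the final assignment of cost 4.\<close>
  moreover have "1 \<le> (n + 1)\<^sup>2"
    by simp
  then have "1 + t1 + (1 + t2 + (1 + t3 + (1 + t4 + 4))) \<le> 104 * (n + 1)\<^sup>2"
    using 1(2) 2(2) 3(2) 4(2) by linarith
  ultimately show ?thesis
    unfolding out n_def by blast
qed

section \<open>Correctness of the output encoding\<close>

lemma encodes_digraphE:
  assumes "encodes_digraph t G"
  obtains v a where "distinct v" "set v = pverts G" "distinct a" "set a = parcs G"
    "t = Branch (list_tree (map id v)) (list_tree (map arc_tree a))"
  using assms unfolding encodes_digraph_def encodes_set_def by blast

lemma inj_fibre_arc: "inj fibre_arc" and inj_row_arc: "inj row_arc"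
  and inj_diagonal_arc: "inj diagonal_arc"
  by (auto intro!: injI)

text \<open>Each half has no repetitions because its arc map is injective. The halves share no arc,
  since a row arc that is also a fibre arc would yield a loop of \<open>H\<close>. The encoding
  \<open>f\<close> is arbitrary, as distinctness is required before it is applied.\<close>

lemma encodes_fibre_part:
  assumes "distinct vG" "distinct aG" "distinct aH"
    and "set vG = pverts G" "set aG = parcs G" "set aH = parcs H" and "pair_digraph H"
  shows "encodes_set f
    (list_tree (map f
      (rev (map row_arc (List.product aG [h])) @ rev (map fibre_arc (List.product vG aH)))))
    (fibre_part G H h)"
  unfolding encodes_set_def
proof (intro exI conjI)
  show "distinct (rev (map row_arc (List.product aG [h])) @ rev (map fibre_arc (List.product vG aH)))"
    using assms pair_digraph_parcs(2)[OF assms(7)]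
    by (auto simp: distinct_map distinct_product
        intro: inj_on_subset[OF inj_row_arc] inj_on_subset[OF inj_fibre_arc])
  show "set (rev (map row_arc (List.product aG [h])) @ rev (map fibre_arc (List.product vG aH))) =
      fibre_part G H h"
    using assms by (auto simp: fibre_part_def)
qed simp

text \<open>The halves are again separated by looplessness of \<open>H\<close>: a row arc keeps the
  second coordinate and a diagonal arc changes it.\<close>

lemma encodes_diagonal_part:
  assumes "distinct aG" "distinct aH" "distinct (h # vH)"
    and "set aG = parcs G" "set aH = parcs H" "set (h # vH) = pverts H" and "pair_digraph H"
  shows "encodes_set f
    (list_tree (map f
      (rev (map row_arc (List.product aG vH)) @ rev (map diagonal_arc (List.product aG aH)))))
    (diagonal_part G H h)"
  unfolding encodes_set_def
proof (intro exI conjI)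
  show "distinct (rev (map row_arc (List.product aG vH)) @ rev (map diagonal_arc (List.product aG aH)))"
    using assms pair_digraph_parcs(2)[OF assms(7)]
    by (auto simp: distinct_map distinct_product
        intro: inj_on_subset[OF inj_row_arc] inj_on_subset[OF inj_diagonal_arc])
  \<comment> \<open>Since the vertex list is distinct, dropping its head removes \<open>h\<close>
    entirely.\<close>
  have "set vH = pverts H - {h}"
    using assms(3,6) by auto
  then show "set (rev (map row_arc (List.product aG vH)) @ rev (map diagonal_arc (List.product aG aH))) =
      diagonal_part G H h"
    using assms(4,5) by (auto simp: diagonal_part_def)
qed simp

section \<open>Existence of the partition and its computation in polynomial time\<close>

theorem theorem3p7:
  shows
    "(\<forall>(G :: 'a pair_pre_digraph) (H :: 'b pair_pre_digraph).
        pair_digraph G \<and> strongly_connected (with_proj G) \<and> card (pverts G) \<ge> 2 \<and>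
        pair_digraph H \<and> strongly_connected (with_proj H) \<and> card (pverts H) \<ge> 2 \<longrightarrow>
        (\<exists>A\<^sub>1 A\<^sub>2. strong_arc_partition (G \<boxtimes> H) A\<^sub>1 A\<^sub>2)) \<and>
     (\<exists>(prog :: com) (p :: nat poly).
        \<forall>(G :: tree pair_pre_digraph) (H :: tree pair_pre_digraph) inp.
          pair_digraph G \<and> strongly_connected (with_proj G) \<and> card (pverts G) \<ge> 2 \<and>
          pair_digraph H \<and> strongly_connected (with_proj H) \<and> card (pverts H) \<ge> 2 \<and>
          encodes_instance inp G H \<longrightarrow>
          (\<exists>out t A\<^sub>1 A\<^sub>2.
             computes prog inp t out \<and> t \<le> poly p (size inp) \<and>
             encodes_arc_sets out A\<^sub>1 A\<^sub>2 \<and> strong_arc_partition (G \<boxtimes> H) A\<^sub>1 A\<^sub>2))"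
proof (intro conjI allI impI)
  fix G :: "'a pair_pre_digraph" and H :: "'b pair_pre_digraph"
  assume *: "pair_digraph G \<and> strongly_connected (with_proj G) \<and> card (pverts G) \<ge> 2 \<and>
    pair_digraph H \<and> strongly_connected (with_proj H) \<and> card (pverts H) \<ge> 2"
  then obtain h where "h \<in> pverts H"
    by (cases "pverts H = {}") auto
  then have "strong_arc_partition (G \<boxtimes> H) (fibre_part G H h) (diagonal_part G H h)"
    using * by (intro strong_arc_partition_strong_product) auto
  then show "\<exists>A\<^sub>1 A\<^sub>2. strong_arc_partition (G \<boxtimes> H) A\<^sub>1 A\<^sub>2"
    by (intro exI)
next
  show "\<exists>(prog :: com) (p :: nat poly).
    \<forall>(G :: tree pair_pre_digraph) (H :: tree pair_pre_digraph) inp.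
      pair_digraph G \<and> strongly_connected (with_proj G) \<and> card (pverts G) \<ge> 2 \<and>
      pair_digraph H \<and> strongly_connected (with_proj H) \<and> card (pverts H) \<ge> 2 \<and>
      encodes_instance inp G H \<longrightarrow>
      (\<exists>out t A\<^sub>1 A\<^sub>2.
         computes prog inp t out \<and> t \<le> poly p (size inp) \<and>
         encodes_arc_sets out A\<^sub>1 A\<^sub>2 \<and> strong_arc_partition (G \<boxtimes> H) A\<^sub>1 A\<^sub>2)"
  \<comment> \<open>The polynomial is 104 (X + 1)^2, the bound proved for
    \<open>partition_program\<close>.\<close>
  proof (intro exI[of _ partition_program] exI[of _ "[:104:] * [:1, 1:]\<^sup>2"] allI impI)
    fix G H :: "tree pair_pre_digraph" and inp
    assume *: "pair_digraph G \<and> strongly_connected (with_proj G) \<and> card (pverts G) \<ge> 2 \<and>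
      pair_digraph H \<and> strongly_connected (with_proj H) \<and> card (pverts H) \<ge> 2 \<and>
      encodes_instance inp G H"
    then obtain tG tH where
      inp: "inp = Branch tG tH" and tG: "encodes_digraph tG G" and tH: "encodes_digraph tH H"
      unfolding encodes_instance_def by blast
    obtain vG aG where G: "distinct vG" "set vG = pverts G" "distinct aG" "set aG = parcs G"
      "tG = Branch (list_tree (map id vG)) (list_tree (map arc_tree aG))"
      using encodes_digraphE[OF tG] .
    obtain vH' aH where H': "distinct vH'" "set vH' = pverts H" "distinct aH" "set aH = parcs H"
      "tH = Branch (list_tree (map id vH')) (list_tree (map arc_tree aH))"
      using encodes_digraphE[OF tH] .
    \<comment> \<open>The program takes \<open>h\<close> from the head of this list, which is
      nonempty because \<open>H\<close> has at least two vertices.\<close>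
    have "vH' \<noteq> []"
      using * H'(2) by auto
    then obtain h vH where vH': "vH' = h # vH"
      by (cases vH') auto
    then have "h \<in> pverts H"
      using H'(2) by auto
    then have part: "strong_arc_partition (G \<boxtimes> H) (fibre_part G H h) (diagonal_part G H h)"
      using * by (intro strong_arc_partition_strong_product) auto
    note H = H'[unfolded vH']
    let ?a1 = "list_tree (map product_arc_tree
      (rev (map row_arc (List.product aG [h])) @ rev (map fibre_arc (List.product vG aH))))"
    let ?a2 = "list_tree (map product_arc_tree
      (rev (map row_arc (List.product aG vH)) @ rev (map diagonal_arc (List.product aG aH))))"
    have pH: "pair_digraph H"
      using * by blast
    obtain t where t: "computes partition_program inp t (Branch ?a1 ?a2)"
      "t \<le> 104 * (size inp + 1)\<^sup>2"
      using partition_program_computes[where vG = vG and aG = aG and h = h and vH = vH and aH = aH]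
      unfolding inp G(5) H(5) by (elim exE conjE)
    have arc_sets:
      "encodes_arc_sets (Branch ?a1 ?a2) (fibre_part G H h) (diagonal_part G H h)"
      unfolding encodes_arc_sets_def
      by (intro exI conjI, rule refl)
        (rule encodes_fibre_part[OF G(1,3) H(3) G(2,4) H(4) pH]
          encodes_diagonal_part[OF G(3) H(3,1) G(4) H(4,2) pH])+
    have "t \<le> poly ([:104:] * [:1, 1:]\<^sup>2) (size inp)"
      using t(2) by (simp add: power2_eq_square algebra_simps)
    with t(1) arc_sets part show "\<exists>out t A\<^sub>1 A\<^sub>2.
        computes partition_program inp t out \<and> t \<le> poly ([:104:] * [:1, 1:]\<^sup>2) (size inp) \<and>
        encodes_arc_sets out A\<^sub>1 A\<^sub>2 \<and> strong_arc_partition (G \<boxtimes> H) A\<^sub>1 A\<^sub>2"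
      by (intro exI conjI)
  qed
qed

end
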